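(* Let $M\in M_n(\mathbb{K})$, with the notation of the context. a) There is a unique set of polynomials $\{B_{ij}(X)\ /\ i=1,\dots,r,\ j=1,\dots,\rho_i\}$ in $\mathbb{F}[X]$ such that $B_{ij}(X)\in\mathbb{K}(\lambda_{i1},\dots,\lambda_{i\rho_i})[X]$ and $\deg B_{ij}(X)<\eta_i$ for every $i,j$, and $$\sum_{i=1}^r\sum_{j=1}^{\rho_i}B_{ij}(X)G_{ij}(X)=1.$$ b) For every $i=1,\dots,r$ and $j=1,\dots,\rho_i$, the polynomial $C_{ij}(X)=B_{ij}(X)G_{ij}(X)$ is in $\mathbb{K}(\lambda_{i1},\dots,\lambda_{i\rho_i})[X]\subseteq\mathbb{F}[X]$ and satisfies $\deg C_{ij}(X)<\deg m(X)$. Moreover the family of matrices $C_{ij}(M)\in M_n(\mathbb{F})$ ($i=1,\dots,r$, $j=1,\dots,\rho_i$) is a Frobenius system with $$\sum_{i=1}^r\sum_{j=1}^{\rho_i}C_{ij}(M)=I_n.$$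
   Context: $\mathbb{K}$ is an arbitrary field, $\overline{\mathbb{K}}$ its algebraic closure. Let $m(X)=m_1(X)^{\mu_1}\cdots m_r(X)^{\mu_r}$ be the minimal polynomial of $M$ over $\mathbb{K}$, with $\mu_i>0$ and $m_1,\dots,m_r$ mutually distinct (monic) irreducible polynomials in $\mathbb{K}[X]$. $\mathbb{F}\subseteq\overline{\mathbb{K}}$ is the splitting field of $m(X)$ over $\mathbb{K}$. For each $i$, $\lambda_{i1},\dots,\lambda_{i\rho_i}$ are the distinct roots of $m_i(X)$ in $\mathbb{F}$. One has $m(X)=\prod_{i=1}^r\prod_{j=1}^{\rho_i}(X-\lambda_{ij})^{\eta_i}$ for suitable integers $\eta_i\ge\mu_i$ (independent of $j$). Put $G_{ij}(X)=m(X)/(X-\lambda_{ij})^{\eta_i}$. A non-empty family of matrices $A_1,\dots,A_p\in M_n(\overline{\mathbb{K}})\setminus\{0\}$ is a Frobenius system if $A_iA_j=\delta_{ij}A_i$ for every $i,j$ ($\delta_{ij}$ the Kronecker symbol). Uniqueness in (a) refers to the polynomials as a family indexed by $(i,j)$. *)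

theory Defs
  imports
    "HOL-Algebra.Generated_Fields"
    "HOL-Algebra.Algebraic_Closure_Type"
    "HOL-Analysis.Cartesian_Space"
    "HOL-Library.FuncSet"
begin

text \<open>
  The base field is a type \<open>'k\<close> of class \<open>field\<close>, its algebraic closure is the library type
  \<open>'k alg_closure\<close> with the embedding \<open>to_ac\<close>, and intermediate fields are subsets of
  \<open>'k alg_closure\<close>.
\<close>

text \<open>The subfield \<open>K(S)\<close> of the algebraic closure.\<close>

definition adjoin :: "'k::field alg_closure set \<Rightarrow> 'k alg_closure set" where
  "adjoin S = generate_field ring_of_type_algebra (range to_ac \<union> S)"

definition splitting_field :: "'k::field poly \<Rightarrow> 'k alg_closure set" where
  "splitting_field p = adjoin {x. poly (map_poly to_ac p) x = 0}"

text \<open>The set \<open>L[X]\<close> of polynomials with coefficients in \<open>L\<close>.\<close>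

definition polys_over :: "'a::zero set \<Rightarrow> 'a poly set" where
  "polys_over L = {p. \<forall>k. coeff p k \<in> L}"

text \<open>
  The value \<open>p(A)\<close> of a polynomial at a square matrix. Powers are iterated matrix products,
  because the overloaded \<open>A ^ k\<close> on vector types would be the entrywise power; \<open>mat c\<close> is the
  scalar matrix with diagonal \<open>c\<close>.
\<close>

definition mat_poly :: "'a::comm_ring_1 poly \<Rightarrow> 'a^'n^'n \<Rightarrow> 'a^'n^'n" where
  "mat_poly p A = (\<Sum>k\<le>degree p. mat (coeff p k) ** (((**) A) ^^ k) (mat 1))"

definition is_min_poly :: "'a::field poly \<Rightarrow> 'a^'n^'n \<Rightarrow> bool" where
  "is_min_poly m A \<longleftrightarrow>
     lead_coeff m = 1 \<and> mat_poly m A = 0 \<and>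
     (\<forall>p. p \<noteq> 0 \<and> mat_poly p A = 0 \<longrightarrow> degree m \<le> degree p)"

definition frobenius_system :: "'i set \<Rightarrow> ('i \<Rightarrow> 'a::field^'n^'n) \<Rightarrow> bool" where
  "frobenius_system I A \<longleftrightarrow>
     finite I \<and> I \<noteq> {} \<and> (\<forall>i\<in>I. A i \<noteq> 0) \<and>
     (\<forall>i\<in>I. \<forall>j\<in>I. A i ** A j = (if i = j then A i else 0))"

text \<open>
  The conditions on the polynomials \<open>B (i, j)\<close>. Here \<open>F\<close> is the big field, \<open>L i\<close> the subfield
  allowed for the coefficients of \<open>B (i, j)\<close>. The degree bounds are used with \<open>\<eta> i > 0\<close>, so that
  the convention \<open>degree 0 = 0\<close> does no harm.
\<close>

definition bezout_family ::
  "nat \<Rightarrow> (nat \<Rightarrow> nat) \<Rightarrow> (nat \<Rightarrow> nat) \<Rightarrow> 'a::field set \<Rightarrow> (nat \<Rightarrow> 'a set) \<Rightarrow>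
   (nat \<Rightarrow> nat \<Rightarrow> 'a poly) \<Rightarrow> (nat \<times> nat \<Rightarrow> 'a poly) \<Rightarrow> bool" where
  "bezout_family r \<rho> \<eta> F L G B \<longleftrightarrow>
     (\<forall>i\<in>{1..r}. \<forall>j\<in>{1..\<rho> i}.
        B (i, j) \<in> polys_over F \<and> B (i, j) \<in> polys_over (L i) \<and> degree (B (i, j)) < \<eta> i) \<and>
     (\<Sum>i=1..r. \<Sum>j=1..\<rho> i. B (i, j) * G i j) = 1"

end

theory Submission
  imports Defs
begin

text \<open>
  Over the closure, the minimal polynomial \<open>m\<close> is a product of powers \<open>(X - a) ^ e\<close> with distinct
  roots \<open>a\<close>: distinct monic irreducible factors over \<open>K\<close> cannot share a root
  (\<open>monic_irreducible_common_root\<close>). Part (a) is the Chinese remainder theorem for these powers.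
  If \<open>g\<close> is the cofactor of \<open>(X - a) ^ e\<close> in \<open>m\<close>, then under the degree bounds the sum of the
  \<open>b * g\<close> is \<open>1\<close> if and only if each \<open>b\<close> inverts its \<open>g\<close> modulo its \<open>(X - a) ^ e\<close>, and below
  degree \<open>e\<close> there is exactly one such \<open>b\<close> (\<open>partition_of_unity_exists\<close>,
  \<open>partition_of_unity_unique\<close>). The fields of coefficients are under control because
  \<open>inverse_mod_linear_power\<close> builds the inverse explicitly from \<open>a\<close> and the coefficients of \<open>g\<close>.

  For part (b), put \<open>c = b * g\<close>. The product of two different \<open>c\<close> is divisible by \<open>m\<close>, so their
  values at \<open>M\<close> annihilate each other. As the values sum to the identity matrix, each of them is
  idempotent. It remains to see that no value is zero. Every \<open>c\<close> is nonzero, and its degree is less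
  than that of \<open>m\<close>, but its coefficients need not be in \<open>K\<close>, so the minimality of \<open>m\<close> over \<open>K\<close>
  has to be carried over to the closure. This is \<open>min_poly_degree_le_alg_closure\<close>: a linear relation over
  the closure between matrices over \<open>K\<close> yields one over \<open>K\<close> by a \<open>K\<close>-linear functional.
\<close>

section \<open>Polynomials with coefficients in a subfield\<close>

lemma subfield_closed:
  fixes L :: "'a::field set"
  assumes "subfield L ring_of_type_algebra"
  shows "0 \<in> L" "1 \<in> L"
    and "x \<in> L \<Longrightarrow> y \<in> L \<Longrightarrow> x + y \<in> L"
    and "x \<in> L \<Longrightarrow> y \<in> L \<Longrightarrow> x * y \<in> L"
    and "x \<in> L \<Longrightarrow> - x \<in> L"
    and "x \<in> L \<Longrightarrow> inverse x \<in> L"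
proof -
  interpret R: field "ring_of_type_algebra :: 'a ring"
    by (rule field_from_type_algebra)
  let ?R = "ring_of_type_algebra :: 'a ring"
  have R: "\<zero>\<^bsub>?R\<^esub> = 0" "\<one>\<^bsub>?R\<^esub> = 1" "\<And>x y. x \<oplus>\<^bsub>?R\<^esub> y = x + y" "\<And>x y. x \<otimes>\<^bsub>?R\<^esub> y = x * y"
    "carrier ?R = UNIV"
    by (simp_all add: ring_of_type_algebra_def)
  have uminus: "\<ominus>\<^bsub>?R\<^esub> x = - x" for x
    using R.l_neg[of x] by (simp add: R eq_neg_iff_add_eq_0)
  have inverse: "inv\<^bsub>?R\<^esub> x = inverse x" if "x \<noteq> 0" for x
    by (rule R.comm_inv_char) (use that in \<open>simp_all add: R\<close>)
  note closed = subringE[OF subfieldE(1)[OF assms]]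
  show "0 \<in> L" "1 \<in> L" using closed(2,3) by (simp_all add: R)
  show "x \<in> L \<Longrightarrow> y \<in> L \<Longrightarrow> x + y \<in> L" "x \<in> L \<Longrightarrow> y \<in> L \<Longrightarrow> x * y \<in> L"
    "x \<in> L \<Longrightarrow> - x \<in> L"
    using closed(5,6,7) by (simp_all add: R uminus)
  show "x \<in> L \<Longrightarrow> inverse x \<in> L"
    using R.subfield_m_inv(1)[OF assms, of x] \<open>0 \<in> L\<close> by (cases "x = 0") (simp_all add: R inverse)
qed

lemma subfield_sum_closed:
  fixes L :: "'a::field set"
  assumes "subfield L ring_of_type_algebra" "\<And>k. k \<in> A \<Longrightarrow> f k \<in> L"
  shows "sum f A \<in> L"
  using assms(2)
  by (induction A rule: infinite_finite_induct) (auto intro: subfield_closed[OF assms(1)])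

lemma subfield_adjoin: "subfield (adjoin S) ring_of_type_algebra"
  unfolding adjoin_def
  by (intro field.generate_field_is_subfield field_from_type_algebra)
     (simp add: ring_of_type_algebra_def)

lemma to_ac_in_adjoin: "to_ac c \<in> adjoin S" and in_adjoin: "x \<in> S \<Longrightarrow> x \<in> adjoin S"
  unfolding adjoin_def by (auto intro: generate_field.incl)

lemma adjoin_mono:
  assumes "S \<subseteq> T"
  shows "adjoin S \<subseteq> adjoin T"
proof
  fix x
  assume "x \<in> adjoin S"
  then show "x \<in> adjoin T"
    unfolding adjoin_def
    by (induction rule: generate_field.induct) (use assms in \<open>auto intro: generate_field.intros\<close>)
qed

lemma polys_over_closed:
  fixes L :: "'a::field set"
  assumes L: "subfield L ring_of_type_algebra"
  shows "0 \<in> polys_over L" "1 \<in> polys_over L"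
    and "p \<in> polys_over L \<Longrightarrow> q \<in> polys_over L \<Longrightarrow> p + q \<in> polys_over L"
    and "p \<in> polys_over L \<Longrightarrow> q \<in> polys_over L \<Longrightarrow> p - q \<in> polys_over L"
    and "p \<in> polys_over L \<Longrightarrow> q \<in> polys_over L \<Longrightarrow> p * q \<in> polys_over L"
    and "c \<in> L \<Longrightarrow> p \<in> polys_over L \<Longrightarrow> smult c p \<in> polys_over L"
    and pCons_in_polys_over: "pCons c p \<in> polys_over L \<longleftrightarrow> c \<in> L \<and> p \<in> polys_over L"
proof -
  note closed = subfield_closed[OF L]
  show "0 \<in> polys_over L" "1 \<in> polys_over L"
    by (auto simp: polys_over_def closed coeff_1)
  show "p \<in> polys_over L \<Longrightarrow> q \<in> polys_over L \<Longrightarrow> p + q \<in> polys_over L"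
    "p \<in> polys_over L \<Longrightarrow> q \<in> polys_over L \<Longrightarrow> p - q \<in> polys_over L"
    using closed(3) closed(3)[OF _ closed(5)] by (auto simp: polys_over_def)
  show "p \<in> polys_over L \<Longrightarrow> q \<in> polys_over L \<Longrightarrow> p * q \<in> polys_over L"
    by (auto simp: polys_over_def coeff_mult intro!: subfield_sum_closed[OF L] closed)
  show "c \<in> L \<Longrightarrow> p \<in> polys_over L \<Longrightarrow> smult c p \<in> polys_over L"
    by (auto simp: polys_over_def closed)
  show "pCons c p \<in> polys_over L \<longleftrightarrow> c \<in> L \<and> p \<in> polys_over L"
    unfolding polys_over_def by (auto simp: coeff_pCons split: nat.splits)
qed

lemma polys_over_power:
  fixes L :: "'a::field set"
  assumes "subfield L ring_of_type_algebra" "p \<in> polys_over L"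
  shows "p ^ n \<in> polys_over L"
  by (induction n) (auto intro: polys_over_closed assms)

lemma polys_over_sum:
  fixes L :: "'a::field set"
  assumes "subfield L ring_of_type_algebra" "\<And>k. k \<in> A \<Longrightarrow> f k \<in> polys_over L"
  shows "sum f A \<in> polys_over L"
  using assms(2)
  by (induction A rule: infinite_finite_induct) (auto intro: polys_over_closed[OF assms(1)])

lemma polys_over_mono: "L \<subseteq> L' \<Longrightarrow> polys_over L \<subseteq> polys_over L'"
  unfolding polys_over_def by auto

lemma poly_in_subfield:
  fixes L :: "'a::field set"
  assumes L: "subfield L ring_of_type_algebra" and "p \<in> polys_over L" "x \<in> L"
  shows "poly p x \<in> L"
  using assms(2,3)
  by (induction p) (auto simp: pCons_in_polys_over[OF L] intro: subfield_closed[OF L])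

text \<open>Long division only uses the field operations on the coefficients.\<close>

lemma polys_over_div_mod:
  fixes L :: "'a::field set"
  assumes L: "subfield L ring_of_type_algebra" and q: "q \<in> polys_over L"
  shows "p \<in> polys_over L \<Longrightarrow> p div q \<in> polys_over L \<and> p mod q \<in> polys_over L"
proof (induction p)
  case 0
  then show ?case by simp
next
  case (pCons a p)
  then have IH: "a \<in> L" "p div q \<in> polys_over L" "p mod q \<in> polys_over L"
    by (auto simp: pCons_in_polys_over[OF L])
  define c where "c = coeff (pCons a (p mod q)) (degree q) / lead_coeff q"
  have rem: "pCons a (p mod q) \<in> polys_over L"
    using IH by (simp add: pCons_in_polys_over[OF L])
  then have "c \<in> L"
    using q unfolding c_def divide_inverse polys_over_def by (auto intro: subfield_closed[OF L])
  then show ?case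
    using IH rem q pCons.prems
    by (auto simp: div_pCons_eq mod_pCons_eq c_def[symmetric] pCons_in_polys_over[OF L]
        intro!: polys_over_closed[OF L])
qed

section \<open>Partitions of unity for coprime powers of linear polynomials\<close>

text \<open>
  Compare the multiplicities of the root \<open>a\<close>: the factor \<open>g\<close> contributes nothing to that of the
  product.
\<close>

lemma linear_power_dvd_cancel:
  fixes a :: "'a::field"
  assumes dvd: "[:- a, 1:] ^ n dvd g * h" and g: "poly g a \<noteq> 0"
  shows "[:- a, 1:] ^ n dvd h"
proof (cases "h = 0")
  case False
  then have "g * h \<noteq> 0"
    using g by auto
  then have "n \<le> Polynomial.order a g + Polynomial.order a h"
    using dvd order_divides[of a n "g * h"] order_mult[of g h a] by auto
  then show ?thesis
    using order_divides[of a n h] order_0I[OF g] by auto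
qed simp

text \<open>
  If \<open>c = g(a)\<close> is nonzero, then \<open>h = 1 - g/c\<close> vanishes at \<open>a\<close>, so that \<open>h ^ n\<close> is zero modulo
  \<open>(X - a) ^ n\<close>. Hence the inverse of \<open>g/c = 1 - h\<close> is the finite geometric series in \<open>h\<close>. The
  coefficients of this explicit inverse stay in every field that contains \<open>a\<close> and the
  coefficients of \<open>g\<close>.
\<close>

lemma inverse_mod_linear_power:
  fixes L :: "'a::field set"
  assumes L: "subfield L ring_of_type_algebra"
    and g: "g \<in> polys_over L" and a: "a \<in> L" and ga: "poly g a \<noteq> 0" and n: "n > 0"
  obtains b where "b \<in> polys_over L" "degree b < n" "[:- a, 1:] ^ n dvd b * g - 1"
proof -
  define d where "d = inverse (poly g a)"
  define h where "h = 1 - smult d g"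
  define s where "s = smult d (\<Sum>k<n. h ^ k)"
  let ?P = "[:- a, 1:] ^ n"
  note closed = subfield_closed[OF L] and pclosed = polys_over_closed[OF L]
  have "d \<in> L"
    unfolding d_def by (intro closed poly_in_subfield[OF L] g a)
  then have h: "h \<in> polys_over L"
    unfolding h_def by (intro pclosed g)
  have s: "s \<in> polys_over L"
    unfolding s_def by (intro pclosed polys_over_sum[OF L] polys_over_power[OF L] h \<open>d \<in> L\<close>)
  have P: "?P \<in> polys_over L"
    by (intro polys_over_power[OF L]) (simp add: pclosed a closed)
  have "[:- a, 1:] dvd h"
    using ga by (simp add: h_def d_def poly_eq_0_iff_dvd[symmetric])
  then have "?P dvd h ^ n"
    by (rule dvd_power_same)
  moreover have "s * g - 1 = - (h ^ n)"
  proof -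
    have "s * g = (1 - h) * (\<Sum>k<n. h ^ k)"
      by (simp add: s_def h_def mult.commute)
    also have "\<dots> = 1 - h ^ n"
      by (simp add: one_diff_power_eq)
    finally show ?thesis by simp
  qed
  ultimately have "?P dvd s * g - 1"
    by simp
  (* s inverts g, and so does its remainder, which has the required degree. *)
  moreover have "?P dvd (s mod ?P) * g - s * g"
    unfolding left_diff_distrib[symmetric]
    by (metis dvd_minus_mod dvd_mult2 dvd_minus_iff minus_diff_eq)
  ultimately have "?P dvd (s mod ?P) * g - 1"
    by (metis (no_types) diff_add_cancel add_diff_eq dvd_add)
  moreover have "degree (s mod ?P) < n"
    using degree_mod_less[of ?P s] n by (auto simp: degree_linear_power)
  ultimately show ?thesis
    using that polys_over_div_mod[OF L P s] by blast
qed

locale linear_powers =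
  fixes I :: "'i set" and a :: "'i \<Rightarrow> 'a::field" and e :: "'i \<Rightarrow> nat"
  assumes finite: "finite I" and nonempty: "I \<noteq> {}" and inj: "inj_on a I"
    and pos: "\<And>k. k \<in> I \<Longrightarrow> e k > 0"
begin

definition P :: "'i \<Rightarrow> 'a poly" where "P k = [:- a k, 1:] ^ e k"

definition cofactor :: "'i \<Rightarrow> 'a poly" where "cofactor k = prod P (I - {k})"

lemma P_nonzero: "P k \<noteq> 0" and degree_P: "degree (P k) = e k"
  by (simp_all add: P_def degree_linear_power)

lemma prod_split: "k \<in> I \<Longrightarrow> prod P I = P k * cofactor k"
  unfolding cofactor_def by (rule prod.remove[OF finite])

lemma degree_prod_split: "k \<in> I \<Longrightarrow> degree (prod P I) = e k + degree (cofactor k)"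
  using P_nonzero finite by (simp add: prod_split degree_mult_eq degree_P cofactor_def)

lemma poly_cofactor_nonzero: "k \<in> I \<Longrightarrow> poly (cofactor k) (a k) \<noteq> 0"
  using finite inj by (auto simp: cofactor_def P_def poly_prod inj_on_def)

lemma P_dvd_cofactor: "k \<in> I \<Longrightarrow> l \<in> I \<Longrightarrow> k \<noteq> l \<Longrightarrow> P k dvd cofactor l"
  unfolding cofactor_def using finite by (intro dvd_prodI) auto

text \<open>
  The roots are distinct, so none of the factors collected so far vanishes at the next root, and
  they can be cancelled one after the other.
\<close>

lemma prod_dvd:
  assumes "\<And>k. k \<in> I \<Longrightarrow> P k dvd p"
  shows "prod P I dvd p"
proof -
  have "prod P J dvd p" if "J \<subseteq> I" for J
    using finite_subset[OF that finite] that
  proof (induction J rule: finite_induct)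
    case (insert k J)
    then obtain h where h: "p = prod P J * h"
      by auto
    have "poly (prod P J) (a k) \<noteq> 0"
      using insert inj by (auto simp: P_def poly_prod inj_on_def)
    moreover have "P k dvd prod P J * h"
      using assms insert.prems h by auto
    ultimately have "P k dvd h"
      unfolding P_def by (rule linear_power_dvd_cancel[rotated])
    then show ?case
      using insert.hyps h by (simp add: mult.commute mult_dvd_mono)
  qed simp
  then show ?thesis by simp
qed

text \<open>Modulo \<open>P k\<close> all terms of the sum vanish except the one with index \<open>k\<close>.\<close>

lemma dvd_sum_cofactor:
  assumes k: "k \<in> I"
  shows "P k dvd (\<Sum>l\<in>I. B l * cofactor l) - B k * cofactor k"
proof -
  have "(\<Sum>l\<in>I. B l * cofactor l) - B k * cofactor k = (\<Sum>l\<in>I - {k}. B l * cofactor l)"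
    using k finite by (simp add: sum_diff1)
  then show ?thesis
    using k by (auto intro!: dvd_sum dvd_mult P_dvd_cofactor)
qed

text \<open>
  The sum of the \<open>B k * cofactor k\<close> is \<open>1\<close> modulo every \<open>P k\<close> as soon as \<open>B k\<close> inverts
  \<open>cofactor k\<close> modulo \<open>P k\<close>. It is then \<open>1\<close> modulo the product of the \<open>P k\<close>, and for degree
  reasons it is equal to \<open>1\<close>.
\<close>

lemma partition_of_unity_exists:
  assumes L: "\<And>k. k \<in> I \<Longrightarrow> subfield (L k) ring_of_type_algebra"
    and a: "\<And>k. k \<in> I \<Longrightarrow> a k \<in> L k"
    and cof: "\<And>k. k \<in> I \<Longrightarrow> cofactor k \<in> polys_over (L k)"
  obtains B where "\<And>k. k \<in> I \<Longrightarrow> B k \<in> polys_over (L k)" "\<And>k. k \<in> I \<Longrightarrow> degree (B k) < e k"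
    "(\<Sum>k\<in>I. B k * cofactor k) = 1"
proof -
  have "\<exists>b. b \<in> polys_over (L k) \<and> degree b < e k \<and> P k dvd b * cofactor k - 1" if "k \<in> I" for k
    by (rule inverse_mod_linear_power[OF L cof a poly_cofactor_nonzero pos, OF that that that that that])
       (auto simp: P_def)
  then obtain B where B: "\<And>k. k \<in> I \<Longrightarrow> B k \<in> polys_over (L k)" "\<And>k. k \<in> I \<Longrightarrow> degree (B k) < e k"
    "\<And>k. k \<in> I \<Longrightarrow> P k dvd B k * cofactor k - 1"
    by metis
  let ?s = "(\<Sum>l\<in>I. B l * cofactor l) - 1"
  have "P k dvd ?s" if "k \<in> I" for k
    using dvd_add[OF dvd_sum_cofactor[OF that] B(3)[OF that], of B] by simp
  then have "prod P I dvd ?s"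
    by (rule prod_dvd)
  moreover have "degree ?s < degree (prod P I)"
  proof (intro degree_diff_less degree_sum_less)
    obtain k where "k \<in> I" using nonempty by auto
    then show "0 < degree (prod P I)" "degree 1 < degree (prod P I)"
      using degree_prod_split pos by auto
  next
    fix k
    assume "k \<in> I"
    then show "degree (B k * cofactor k) < degree (prod P I)"
      using degree_mult_le[of "B k" "cofactor k"] B(2) degree_prod_split by fastforce
  qed
  ultimately have "?s = 0"
    using dvd_imp_degree_le[of "prod P I" ?s] by fastforce
  with B show ?thesis
    by (intro that[of B]) auto
qed

text \<open>
  Modulo \<open>P k\<close> the sum determines \<open>B k * cofactor k\<close>, and \<open>cofactor k\<close> can be cancelled because
  it does not vanish at \<open>a k\<close>. So \<open>B k\<close> is determined modulo \<open>P k\<close>, whose degree is \<open>e k\<close>.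
\<close>

lemma partition_of_unity_unique:
  assumes eq: "(\<Sum>k\<in>I. B k * cofactor k) = (\<Sum>k\<in>I. B' k * cofactor k)"
    and k: "k \<in> I" and deg: "degree (B k) < e k" "degree (B' k) < e k"
  shows "B k = B' k"
proof -
  have "P k dvd (\<Sum>l\<in>I. (B l - B' l) * cofactor l) - (B k - B' k) * cofactor k"
    using dvd_sum_cofactor[OF k, of "\<lambda>l. B l - B' l"] .
  then have "P k dvd cofactor k * (B k - B' k)"
    using eq by (simp add: left_diff_distrib sum_subtractf mult.commute dvd_diff_commute)
  then have "P k dvd B k - B' k"
    using poly_cofactor_nonzero[OF k] unfolding P_def by (rule linear_power_dvd_cancel)
  moreover have "degree (B k - B' k) < degree (P k)"
    using degree_diff_less deg by (simp add: degree_P)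
  ultimately show ?thesis
    using dvd_imp_degree_le[of "P k" "B k - B' k"] by fastforce
qed

text \<open>
  The second factor is divisible by \<open>P k\<close>, which is what the first one lacks.
\<close>

lemma partition_of_unity_orthogonal:
  assumes "k \<in> I" "l \<in> I" "k \<noteq> l"
  shows "prod P I dvd (B k * cofactor k) * (B l * cofactor l)"
proof -
  have "P k * cofactor k dvd cofactor l * cofactor k"
    using P_dvd_cofactor[OF assms] by (rule mult_dvd_mono) simp
  then have "P k * cofactor k dvd (cofactor l * cofactor k) * (B k * B l)"
    by (rule dvd_mult2)
  then show ?thesis
    using assms by (simp add: prod_split[of k] mult_ac)
qed

text \<open>
  The member with index \<open>k\<close> is \<open>1\<close> modulo the nonunit \<open>P k\<close>, because \<open>P k\<close> divides all the others.
\<close>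

lemma partition_of_unity_nonzero:
  assumes "(\<Sum>k\<in>I. B k * cofactor k) = 1" and k: "k \<in> I"
  shows "B k * cofactor k \<noteq> 0"
proof
  assume "B k * cofactor k = 0"
  then have "P k dvd 1"
    using dvd_sum_cofactor[OF k, of B] unfolding assms(1) by (metis diff_zero)
  then show False
    using dvd_imp_degree_le[of "P k" 1] pos[OF k] by (simp add: degree_P)
qed

end

section \<open>Polynomials in a matrix\<close>

lemma scalar_mat_mult_nth:
  fixes Y :: "'a::comm_ring_1^'n^'n"
  shows "(mat c ** Y) $ i $ j = c * Y $ i $ j" "(Y ** mat c) $ i $ j = c * Y $ i $ j"
  by (simp_all add: matrix_matrix_mult_def mat_def if_distrib if_distribR mult.commute cong: if_cong)

lemma scalar_mat_commute:
  fixes Y :: "'a::comm_ring_1^'n^'n"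
  shows "Y ** mat c = mat c ** Y"
  by (simp add: vec_eq_iff scalar_mat_mult_nth)

lemma scalar_mat_left_commute:
  fixes A Y :: "'a::comm_ring_1^'n^'n"
  shows "mat c ** (A ** Y) = A ** (mat c ** Y)"
  unfolding matrix_mul_assoc scalar_mat_commute[of A] ..

lemma mat_add: "mat (c + d) = (mat c + mat d :: 'a::comm_ring_1^'n^'n)"
  by (simp add: vec_eq_iff mat_def)

lemma matrix_add_mult_distrib:
  fixes A :: "'a::comm_ring_1^'n^'n"
  shows "(A + B) ** C = A ** C + B ** C"
  by (simp add: vec_eq_iff matrix_matrix_mult_def distrib_right sum.distrib)

lemma mat_poly_bound:
  fixes A :: "'a::comm_ring_1^'n^'n"
  assumes "degree p \<le> N"
  shows "mat_poly p A = (\<Sum>k\<le>N. mat (coeff p k) ** (((**) A) ^^ k) (mat 1))"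
  unfolding mat_poly_def
  by (intro sum.mono_neutral_left) (use assms in \<open>auto simp: coeff_eq_0\<close>)

lemma matrix_mult_sum_right:
  fixes A :: "'a::comm_ring_1^'n^'n"
  shows "A ** sum f S = (\<Sum>k\<in>S. A ** f k)"
  by (induction S rule: infinite_finite_induct) (simp_all add: matrix_add_ldistrib)

lemma mat_poly_pCons:
  fixes A :: "'a::comm_ring_1^'n^'n"
  shows "mat_poly (pCons c p) A = mat c + A ** mat_poly p A"
proof -
  have "mat_poly (pCons c p) A =
      (\<Sum>k\<le>Suc (degree p). mat (coeff (pCons c p) k) ** (((**) A) ^^ k) (mat 1))"
    by (rule mat_poly_bound) (rule degree_pCons_le)
  also have "\<dots> = mat c + (\<Sum>k\<le>degree p. A ** (mat (coeff p k) ** (((**) A) ^^ k) (mat 1)))"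
    unfolding sum.atMost_Suc_shift by (simp add: scalar_mat_left_commute)
  also have "\<dots> = mat c + A ** mat_poly p A"
    by (simp add: mat_poly_def matrix_mult_sum_right)
  finally show ?thesis .
qed

lemma mat_poly_0: "mat_poly 0 A = 0"
  by (simp add: mat_poly_def)

lemma mat_poly_1: "mat_poly 1 A = mat 1"
  by (simp add: mat_poly_def)

lemma mat_poly_add:
  fixes A :: "'a::comm_ring_1^'n^'n"
  shows "mat_poly (p + q) A = mat_poly p A + mat_poly q A"
proof -
  define N where "N = max (degree p) (degree q)"
  have "degree p \<le> N" "degree q \<le> N" "degree (p + q) \<le> N"
    by (simp_all add: N_def degree_add_le_max)
  then show ?thesis
    by (simp add: mat_poly_bound mat_add matrix_add_mult_distrib sum.distrib)
qed

lemma mat_poly_sum: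
  fixes A :: "'a::comm_ring_1^'n^'n"
  shows "mat_poly (sum f S) A = (\<Sum>k\<in>S. mat_poly (f k) A)"
  by (induction S rule: infinite_finite_induct) (simp_all add: mat_poly_0 mat_poly_add)

lemma mat_poly_smult:
  fixes A :: "'a::comm_ring_1^'n^'n"
  shows "mat_poly (smult c p) A = mat c ** mat_poly p A"
proof (induction p)
  case (pCons d p)
  have scalar: "mat (c * d) = mat c ** (mat d :: 'a^'n^'n)"
    unfolding vec_eq_iff scalar_mat_mult_nth by (simp add: mat_def)
  have "mat_poly (smult c (pCons d p)) A = mat (c * d) + A ** (mat c ** mat_poly p A)"
    by (simp add: mat_poly_pCons pCons.IH)
  also have "\<dots> = mat c ** mat_poly (pCons d p) A"
    unfolding scalar scalar_mat_left_commute[where A = A, symmetric] mat_poly_pCons matrix_add_ldistrib ..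
  finally show ?case .
qed (simp add: mat_poly_0)

lemma mat_poly_mult:
  fixes A :: "'a::comm_ring_1^'n^'n"
  shows "mat_poly (p * q) A = mat_poly p A ** mat_poly q A"
proof (induction p)
  case (pCons c p)
  then show ?case
    by (simp add: mat_poly_pCons mat_poly_add mat_poly_smult matrix_add_mult_distrib matrix_mul_assoc)
qed (simp add: mat_poly_0)

lemma mat_poly_dvd:
  fixes A :: "'a::comm_ring_1^'n^'n"
  assumes "m dvd p" "mat_poly m A = 0"
  shows "mat_poly p A = 0"
  using assms by (auto simp: mat_poly_mult)

lemma mat_poly_in_subfield:
  fixes A :: "'a::field^'n^'n"
  assumes L: "subfield L ring_of_type_algebra" and A: "\<And>i j. A $ i $ j \<in> L"
    and p: "p \<in> polys_over L"
  shows "mat_poly p A $ i $ j \<in> L"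
  using p
proof (induction p arbitrary: i j)
  case (pCons c p)
  then show ?case
    by (auto simp: mat_poly_pCons mat_def matrix_matrix_mult_def A pCons_in_polys_over[OF L]
        intro!: subfield_closed[OF L] subfield_sum_closed[OF L])
qed (simp add: mat_poly_0 subfield_closed[OF L])

text \<open>
  Additivity and semilinearity suffice, since the matrix whose powers are taken has entries in the
  scalars with respect to which \<open>f\<close> is semilinear. This form covers both directions between a field and an
  extension: a field embedding \<open>f = g\<close> with \<open>h = id\<close>, and a functional \<open>f\<close> that is linear over
  the small field, with \<open>h\<close> the embedding and \<open>g = id\<close>.
\<close>

lemma map_matrix_mat_poly:
  fixes M :: "'c^'n^'n" and p :: "'a::comm_ring_1 poly" and f :: "'a \<Rightarrow> 'b::comm_ring_1"
  assumes add: "\<And>x y. f (x + y) = f x + f y"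
    and scale: "\<And>c x. f (h c * x) = g c * f x"
  shows "map_matrix f (mat_poly p (map_matrix h M)) = mat_poly (map_poly f p) (map_matrix g M)"
proof -
  have f0: "f 0 = 0"
    using add[of 0 0] by simp
  have f_sum: "f (sum t S) = (\<Sum>k\<in>S. f (t k))" for t and S :: "'n set"
    by (induction S rule: infinite_finite_induct) (simp_all add: f0 add)
  have "f (mat_poly p (map_matrix h M) $ i $ j) = mat_poly (map_poly f p) (map_matrix g M) $ i $ j"
    for i j
  proof (induction p arbitrary: i j)
    case (pCons c p)
    then show ?case
      by (simp add: mat_poly_pCons map_poly_pCons f0 add mat_def matrix_matrix_mult_def f_sum scale)
  qed (simp add: mat_poly_0 f0)
  then show ?thesis
    by (simp add: vec_eq_iff)
qed

section \<open>The minimal polynomial over the algebraic closure\<close>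

text \<open>
  View the closure as a vector space over \<open>K\<close> and extend \<open>c\<close> to a basis. The coordinate along
  \<open>c\<close> is the functional.
\<close>

lemma exists_linear_functional:
  fixes c :: "'k::field alg_closure"
  assumes "c \<noteq> 0"
  shows "\<exists>f :: 'k alg_closure \<Rightarrow> 'k.
    (\<forall>x y. f (x + y) = f x + f y) \<and> (\<forall>b x. f (to_ac b * x) = b * f x) \<and> f c \<noteq> 0"
proof -
  interpret V: vector_space "\<lambda>b (x :: 'k alg_closure). to_ac b * x"
    by standard (simp_all add: algebra_simps)
  have "V.independent {c}"
    using assms by simp
  then have B: "V.independent (V.extend_basis {c})" "V.span (V.extend_basis {c}) = UNIV"
    "c \<in> V.extend_basis {c}"
    using V.independent_extend_basis V.span_extend_basis V.extend_basis_superset[of "{c}"] by auto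
  then show ?thesis
    by (intro exI[of _ "\<lambda>x. V.representation (V.extend_basis {c}) x c"])
       (simp add: V.representation_basis V.representation_add V.representation_scale)
qed

text \<open>
  A polynomial over the closure that annihilates \<open>M\<close> is a linear relation between the powers of
  \<open>M\<close>. A \<open>K\<close>-linear functional that does not kill its leading coefficient carries it to a
  relation over \<open>K\<close> of the same degree.
\<close>

lemma min_poly_degree_le_alg_closure:
  fixes M :: "'k::field^'n^'n" and p :: "'k alg_closure poly"
  assumes m: "is_min_poly m M" and p: "p \<noteq> 0" "mat_poly p (map_matrix to_ac M) = 0"
  shows "degree m \<le> degree p"
proof -
  have "lead_coeff p \<noteq> 0"
    using p(1) by simp
  then obtain f :: "'k alg_closure \<Rightarrow> 'k" where
    "(\<forall>x y. f (x + y) = f x + f y) \<and> (\<forall>b x. f (to_ac b * x) = b * f x) \<and> f (lead_coeff p) \<noteq> 0"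
    by (rule exE[OF exists_linear_functional])
  then have f: "f (x + y) = f x + f y" "f (to_ac b * x) = b * f x" "f (lead_coeff p) \<noteq> 0" for x y b
    by blast+
  have f0: "f 0 = 0"
    using f(2)[of 0 0] by simp
  have "map_matrix f (mat_poly p (map_matrix to_ac M)) = mat_poly (map_poly f p) (map_matrix id M)"
    by (rule map_matrix_mat_poly) (simp_all add: f)
  moreover have "map_matrix id M = M" "map_matrix f 0 = (0 :: 'k^'n^'n)"
    by (simp_all add: vec_eq_iff f0)
  ultimately have "mat_poly (map_poly f p) M = 0"
    using p(2) by simp
  moreover have "map_poly f p \<noteq> 0"
    using f(3) by (metis coeff_map_poly f0 coeff_0)
  ultimately have "degree m \<le> degree (map_poly f p)"
    using m unfolding is_min_poly_def by blast
  also have "\<dots> \<le> degree p"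
    by (rule map_poly_degree_leq)
  finally show ?thesis .
qed

section \<open>Irreducible polynomials with a common root\<close>

lemma degree_map_poly_to_ac: "degree (map_poly to_ac p) = degree p"
  by (rule degree_map_poly) simp

lemma poly_to_ac_add:
  "poly (map_poly to_ac (p + q)) x = poly (map_poly to_ac p) x + poly (map_poly to_ac q) x"
proof -
  have "map_poly to_ac (p + q) = map_poly to_ac p + map_poly to_ac q"
    by (rule poly_eqI) (simp add: coeff_map_poly)
  then show ?thesis by simp
qed

lemma poly_to_ac_mult:
  "poly (map_poly to_ac (p * q)) x = poly (map_poly to_ac p) x * poly (map_poly to_ac q) x"
  by (induction p) (simp_all add: poly_to_ac_add map_poly_pCons map_poly_smult algebra_simps)

text \<open>
  Both polynomials are associated to a nonzero polynomial over \<open>K\<close> of least degree among those that vanish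
  at \<open>x\<close>.
\<close>

lemma monic_irreducible_common_root:
  fixes p q :: "'k::field poly"
  assumes "irreducible p" "lead_coeff p = 1" "poly (map_poly to_ac p) x = 0"
    and "irreducible q" "lead_coeff q = 1" "poly (map_poly to_ac q) x = 0"
  shows "p = q"
proof -
  let ?Z = "\<lambda>d :: 'k poly. d \<noteq> 0 \<and> poly (map_poly to_ac d) x = 0"
  have "?Z p"
    using assms by auto
  then obtain d where d: "?Z d" and least: "\<And>u. ?Z u \<Longrightarrow> degree d \<le> degree u"
    using ex_has_least_nat[of ?Z p degree] by blast
  have "\<not> d dvd 1"
  proof
    assume "d dvd 1"
    then obtain c where "d = [:c:]"
      using is_unit_poly_iff by blast
    then show False
      using d by (simp add: map_poly_pCons)
  qed
  moreover have dvd: "d dvd u" if "poly (map_poly to_ac u) x = 0" for u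
  proof -
    have "poly (map_poly to_ac (u div d * d + u mod d)) x = 0"
      using that by simp
    then have "poly (map_poly to_ac (u mod d)) x = 0"
      using d unfolding poly_to_ac_add poly_to_ac_mult by simp
    then have "u mod d = 0"
      using least[of "u mod d"] degree_mod_less[of d u] d by fastforce
    then show ?thesis by auto
  qed
  ultimately have "p dvd d" "q dvd d"
    using irreducibleD' assms by blast+
  then have "p dvd q" "q dvd p"
    using dvd assms dvd_trans by blast+
  then obtain u where u: "q = p * u" and "u dvd 1"
    by (metis dvd_mult_cancel_left dvdE mult.right_neutral assms(2) leading_coeff_0_iff zero_neq_one)
  then obtain c where "u = [:c:]"
    using is_unit_poly_iff by blast
  then have "lead_coeff q = c * lead_coeff p"
    unfolding u lead_coeff_mult by simp
  then have "c = 1"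
    unfolding assms(2,5) by simp
  then show ?thesis
    using u \<open>u = [:c:]\<close> by simp
qed

section \<open>The Frobenius system of a matrix\<close>

theorem proposition1p5:
  fixes M :: "'k::field^'n^'n"
    and m :: "'k poly" and r :: nat and q :: "nat \<Rightarrow> 'k poly" and \<mu> :: "nat \<Rightarrow> nat"
    and F :: "'k alg_closure set"
    and \<rho> :: "nat \<Rightarrow> nat" and lam :: "nat \<Rightarrow> nat \<Rightarrow> 'k alg_closure" and \<eta> :: "nat \<Rightarrow> nat"
    and L :: "nat \<Rightarrow> 'k alg_closure set" and G :: "nat \<Rightarrow> nat \<Rightarrow> 'k alg_closure poly"
  assumes m: "is_min_poly m M"
    and q_irreducible: "\<And>i. i \<in> {1..r} \<Longrightarrow> irreducible (q i)"
    and q_monic: "\<And>i. i \<in> {1..r} \<Longrightarrow> lead_coeff (q i) = 1"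
    and q_distinct: "inj_on q {1..r}"
    and \<mu>_pos: "\<And>i. i \<in> {1..r} \<Longrightarrow> \<mu> i > 0"
    and m_factorization: "m = (\<Prod>i=1..r. q i ^ \<mu> i)"
    and F: "F = splitting_field m"
    and roots: "\<And>i. i \<in> {1..r} \<Longrightarrow>
      bij_betw (lam i) {1..\<rho> i} {x \<in> F. poly (map_poly to_ac (q i)) x = 0}"
    and \<eta>_ge: "\<And>i. i \<in> {1..r} \<Longrightarrow> \<eta> i \<ge> \<mu> i"
    and m_splitting: "map_poly to_ac m = (\<Prod>i=1..r. \<Prod>j=1..\<rho> i. [:- lam i j, 1:] ^ \<eta> i)"
    and L: "\<And>i. L i = adjoin (lam i ` {1..\<rho> i})"
    and G: "\<And>i j. G i j = map_poly to_ac m div [:- lam i j, 1:] ^ \<eta> i"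
  shows "(\<exists>!B. B \<in> extensional (SIGMA i:{1..r}. {1..\<rho> i}) \<and> bezout_family r \<rho> \<eta> F L G B) \<and>
    (\<forall>B C. bezout_family r \<rho> \<eta> F L G B \<and> C = (\<lambda>(i, j). B (i, j) * G i j) \<longrightarrow>
      (\<forall>i\<in>{1..r}. \<forall>j\<in>{1..\<rho> i}.
         C (i, j) \<in> polys_over (L i) \<and> polys_over (L i) \<subseteq> polys_over F \<and>
         degree (C (i, j)) < degree m) \<and>
      (\<forall>i\<in>{1..r}. \<forall>j\<in>{1..\<rho> i}. \<forall>a b. mat_poly (C (i, j)) (map_matrix to_ac M) $ a $ b \<in> F) \<and>
      frobenius_system (SIGMA i:{1..r}. {1..\<rho> i})
        (\<lambda>ij. mat_poly (C ij) (map_matrix to_ac M)) \<and>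
      (\<Sum>i=1..r. \<Sum>j=1..\<rho> i. mat_poly (C (i, j)) (map_matrix to_ac M)) = mat 1)"
proof -
  define I where "I = (SIGMA i:{1..r}. {1..\<rho> i})"
  define A where "A = map_matrix to_ac M"
  let ?m = "map_poly to_ac m"
  have \<eta>_pos: "\<eta> i > 0" if "i \<in> {1..r}" for i
    using \<mu>_pos[OF that] \<eta>_ge[OF that] by simp
  have lam: "poly (map_poly to_ac (q i)) (lam i j) = 0" if "i \<in> {1..r}" "j \<in> {1..\<rho> i}" for i j
    using bij_betwE[OF roots] that by blast
  have m_A: "mat_poly ?m A = 0"
  proof -
    have "map_matrix to_ac (mat_poly m (map_matrix id M)) = mat_poly ?m A"
      unfolding A_def by (rule map_matrix_mat_poly) simp_all
    moreover have "map_matrix id M = M" "map_matrix to_ac 0 = (0 :: 'k alg_closure^'n^'n)"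
      by (simp_all add: vec_eq_iff)
    ultimately show ?thesis
      using m by (simp add: is_min_poly_def)
  qed
  have m_prod: "?m = (\<Prod>k\<in>I. [:- (case k of (i, j) \<Rightarrow> lam i j), 1:] ^ (case k of (i, j) \<Rightarrow> \<eta> i))"
    unfolding m_splitting I_def by (subst prod.Sigma) (auto intro: prod.cong)
  interpret linear_powers I "\<lambda>(i, j). lam i j" "\<lambda>(i, j). \<eta> i"
  proof
    show "finite I"
      by (simp add: I_def)
    have "mat_poly 1 A \<noteq> 0"
      by (simp add: mat_poly_1 mat_def vec_eq_iff)
    then show "I \<noteq> {}"
      using m_A m_prod by auto
    show "inj_on (\<lambda>(i, j). lam i j) I"
    proof (rule inj_onI, clarify)
      fix i j i' j'
      assume ij: "(i, j) \<in> I" "(i', j') \<in> I" and eq: "lam i j = lam i' j'"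
      then have i: "i \<in> {1..r}" "i' \<in> {1..r}" and j: "j \<in> {1..\<rho> i}" "j' \<in> {1..\<rho> i'}"
        by (auto simp: I_def)
      have "q i = q i'"
        by (rule monic_irreducible_common_root[where x = "lam i j"])
           (use lam i j q_irreducible q_monic eq in metis)+
      then have "i = i'"
        by (rule inj_onD[OF q_distinct _ i])
      moreover have "inj_on (lam i) {1..\<rho> i}"
        using roots[OF i(1)] by (rule bij_betw_imp_inj_on)
      ultimately show "i = i' \<and> j = j'"
        using j eq by (metis inj_onD)
    qed
    show "0 < (case k of (i, j) \<Rightarrow> \<eta> i)" if "k \<in> I" for k
      using that \<eta>_pos by (auto simp: I_def)
  qed
  (* From here on P and cofactor refer to the factorization of m over the closure. *)
  have m_P: "?m = prod P I"
    by (simp add: m_prod P_def)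
  have cofactor: "cofactor (i, j) = G i j" if "(i, j) \<in> I" for i j
  proof -
    have "G i j = prod P I div P (i, j)"
      unfolding m_P[symmetric] G P_def by simp
    also have "\<dots> = P (i, j) * cofactor (i, j) div P (i, j)"
      unfolding prod_split[OF that] ..
    finally show ?thesis
      using P_nonzero by simp
  qed

  have L_field: "subfield (L i) ring_of_type_algebra" for i
    unfolding L by (rule subfield_adjoin)
  have F_field: "subfield F ring_of_type_algebra"
    unfolding F splitting_field_def by (rule subfield_adjoin)
  have lam_L: "lam i j \<in> L i" if "(i, j) \<in> I" for i j
    using that unfolding L I_def by (auto intro: in_adjoin)
  have "poly ?m (lam i j) = 0" if "(i, j) \<in> I" for i j
    using that finite \<eta>_pos by (force simp: m_prod poly_prod I_def)
  then have L_F: "L i \<subseteq> F" if "i \<in> {1..r}" for i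
    unfolding L F splitting_field_def using that by (intro adjoin_mono) (auto simp: I_def)
  have G_L: "G i j \<in> polys_over (L i)" if "(i, j) \<in> I" for i j
  proof -
    have "?m \<in> polys_over (L i)"
      by (simp add: polys_over_def coeff_map_poly L to_ac_in_adjoin)
    moreover have "[:- lam i j, 1:] ^ \<eta> i \<in> polys_over (L i)"
      using lam_L[OF that]
      by (intro polys_over_power[OF L_field])
         (simp add: pCons_in_polys_over[OF L_field] polys_over_closed[OF L_field]
           subfield_closed[OF L_field])
    ultimately show ?thesis
      unfolding G using polys_over_div_mod[OF L_field] by blast
  qed

  have sum_I: "(\<Sum>i=1..r. \<Sum>j=1..\<rho> i. f (i, j)) = sum f I" for f :: "nat \<times> nat \<Rightarrow> 'z::comm_monoid_add"
    unfolding I_def by (subst sum.Sigma) auto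
  have bezout: "bezout_family r \<rho> \<eta> F L G B \<longleftrightarrow>
      (\<forall>(i, j)\<in>I. B (i, j) \<in> polys_over (L i) \<and> degree (B (i, j)) < \<eta> i) \<and>
      (\<Sum>k\<in>I. B k * cofactor k) = 1" for B
  proof -
    have sum: "(\<Sum>i=1..r. \<Sum>j=1..\<rho> i. B (i, j) * G i j) = (\<Sum>k\<in>I. B k * cofactor k)"
      unfolding sum_I[symmetric]
    proof (intro sum.cong refl)
      fix i j
      assume "i \<in> {1..r}" "j \<in> {1..\<rho> i}"
      then have "(i, j) \<in> I"
        by (simp add: I_def)
      then show "B (i, j) * G i j = B (i, j) * cofactor (i, j)"
        by (simp add: cofactor)
    qed
    have ball: "(\<forall>(i, j)\<in>I. Q i j) \<longleftrightarrow> (\<forall>i\<in>{1..r}. \<forall>j\<in>{1..\<rho> i}. Q i j)" for Q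
      by (auto simp: I_def)
    have "p \<in> polys_over F" if "i \<in> {1..r}" "p \<in> polys_over (L i)" for i p
      using polys_over_mono[OF L_F] that by blast
    then show ?thesis
      unfolding bezout_family_def sum ball by blast
  qed

  have ex1: "\<exists>!B. B \<in> extensional I \<and> bezout_family r \<rho> \<eta> F L G B"
  proof (rule ex_ex1I)
    obtain B where B: "\<And>k. k \<in> I \<Longrightarrow> B k \<in> polys_over (L (fst k))"
      "\<And>k. k \<in> I \<Longrightarrow> degree (B k) < (case k of (i, j) \<Rightarrow> \<eta> i)" "(\<Sum>k\<in>I. B k * cofactor k) = 1"
      by (rule partition_of_unity_exists[of "\<lambda>k. L (fst k)"])
         (use L_field lam_L G_L cofactor in auto)
    then have "bezout_family r \<rho> \<eta> F L G (restrict B I)"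
      unfolding bezout by fastforce
    then show "\<exists>B. B \<in> extensional I \<and> bezout_family r \<rho> \<eta> F L G B"
      using restrict_extensional by blast
  next
    fix B B'
    assume B: "B \<in> extensional I \<and> bezout_family r \<rho> \<eta> F L G B"
      "B' \<in> extensional I \<and> bezout_family r \<rho> \<eta> F L G B'"
    show "B = B'"
    proof (rule extensionalityI)
      fix k
      assume k: "k \<in> I"
      show "B k = B' k"
        by (rule partition_of_unity_unique[OF _ k]) (use B k in \<open>auto simp: bezout\<close>)
    qed (use B in auto)
  qed

  have family:
    "(\<forall>i\<in>{1..r}. \<forall>j\<in>{1..\<rho> i}.
        C (i, j) \<in> polys_over (L i) \<and> polys_over (L i) \<subseteq> polys_over F \<and>
        degree (C (i, j)) < degree m) \<and>
     (\<forall>i\<in>{1..r}. \<forall>j\<in>{1..\<rho> i}. \<forall>a b. mat_poly (C (i, j)) A $ a $ b \<in> F) \<and>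
     frobenius_system I (\<lambda>k. mat_poly (C k) A) \<and>
     (\<Sum>i=1..r. \<Sum>j=1..\<rho> i. mat_poly (C (i, j)) A) = mat 1"
    if B: "bezout_family r \<rho> \<eta> F L G B" and C: "C = (\<lambda>(i, j). B (i, j) * G i j)" for B C
  proof -
    have C_cofactor: "C k = B k * cofactor k" if "k \<in> I" for k
      using that cofactor by (cases k) (simp add: C)
    have sum_C: "(\<Sum>k\<in>I. B k * cofactor k) = 1"
      using B unfolding bezout by blast
    have C_L: "C (i, j) \<in> polys_over (L i)" if "(i, j) \<in> I" for i j
      using that B G_L[OF that] unfolding bezout
      by (auto simp: C intro!: polys_over_closed[OF L_field])
    have deg: "degree (C (i, j)) < degree m" if "(i, j) \<in> I" for i j
    proof -
      have "degree (C (i, j)) \<le> degree (B (i, j)) + degree (cofactor (i, j))"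
        unfolding C_cofactor[OF that] by (rule degree_mult_le)
      also have "\<dots> < \<eta> i + degree (cofactor (i, j))"
        using B that unfolding bezout by auto
      also have "\<dots> = degree m"
        using degree_prod_split[OF that] degree_map_poly_to_ac[of m] by (simp add: m_P)
      finally show ?thesis .
    qed
    have entries: "mat_poly (C (i, j)) A $ a $ b \<in> F" if "(i, j) \<in> I" for i j a b
      using C_L[OF that] polys_over_mono[OF L_F] that
      by (intro mat_poly_in_subfield[OF F_field])
         (auto simp: A_def I_def F splitting_field_def to_ac_in_adjoin)
    have sum_A: "(\<Sum>k\<in>I. mat_poly (C k) A) = mat 1"
      using sum_C by (simp add: C_cofactor mat_poly_sum[symmetric] mat_poly_1)
    have orth: "mat_poly (C k) A ** mat_poly (C l) A = 0" if "k \<in> I" "l \<in> I" "k \<noteq> l" for k l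
    proof -
      have "?m dvd C k * C l"
        using partition_of_unity_orthogonal[OF that] that by (simp add: C_cofactor m_P)
      then show ?thesis
        using m_A unfolding mat_poly_mult[symmetric] by (rule mat_poly_dvd)
    qed
    have idem: "mat_poly (C k) A ** mat_poly (C k) A = mat_poly (C k) A" if "k \<in> I" for k
    proof -
      have "mat_poly (C k) A = mat_poly (C k) A ** (\<Sum>l\<in>I. mat_poly (C l) A)"
        by (simp add: sum_A)
      also have "\<dots> = (\<Sum>l\<in>I. mat_poly (C k) A ** mat_poly (C l) A)"
        by (rule matrix_mult_sum_right)
      also have "\<dots> = (\<Sum>l\<in>{k}. mat_poly (C k) A ** mat_poly (C l) A)"
        using that orth by (intro sum.mono_neutral_right[OF finite]) blast+
      finally show ?thesis by simp
    qed
    have nonzero: "mat_poly (C k) A \<noteq> 0" if "k \<in> I" for k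
    proof
      assume "mat_poly (C k) A = 0"
      moreover have "C k \<noteq> 0"
        using partition_of_unity_nonzero[OF sum_C that] by (simp add: C_cofactor that)
      ultimately have "degree m \<le> degree (C k)"
        using min_poly_degree_le_alg_closure[OF m] unfolding A_def by blast
      then show False
        using deg that by (cases k) force
    qed
    have "frobenius_system I (\<lambda>k. mat_poly (C k) A)"
      unfolding frobenius_system_def
    proof (intro conjI ballI finite nonempty nonzero)
      fix k l
      assume "k \<in> I" "l \<in> I"
      then show "mat_poly (C k) A ** mat_poly (C l) A = (if k = l then mat_poly (C k) A else 0)"
        using orth idem by (cases "k = l") simp_all
    qed
    moreover have "(\<Sum>i=1..r. \<Sum>j=1..\<rho> i. mat_poly (C (i, j)) A) = mat 1"
      using sum_I[of "\<lambda>k. mat_poly (C k) A"] sum_A by simp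
    moreover have "(i, j) \<in> I" if "i \<in> {1..r}" "j \<in> {1..\<rho> i}" for i j
      using that by (simp add: I_def)
    ultimately show ?thesis
      using C_L deg entries polys_over_mono[OF L_F] by blast
  qed
  show ?thesis
    by (intro conjI[OF ex1[unfolded I_def]] allI impI)
       (erule conjE, drule (1) family[unfolded I_def A_def], assumption)
qed

end
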